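(* Let $z_1,\dots,z_K\in\Omega$ be target points, $d_1,\dots,d_K>0$, and let $R_K=(d_1,\dots,d_K)$ be the associated reflecting surface. For $0<\lambda<1$ let $$\tilde\rho_\lambda(x)=-\lambda\log\Bigl[\sum_{i=1}^K\exp\Bigl(-\frac{f(x,z_i)}{\lambda}\Bigr)\Bigr],\qquad f(x,z_i)=\frac{d_i}{1-\varepsilon_i(\hat z_i\cdot x)},\quad x\in\varGamma,$$ be the softmin smooth polar radius of $R_K$, where $\hat z_i=z_i/|z_i|$ and $\varepsilon_i=\sqrt{1+d_i^2/|z_i|^2}-d_i/|z_i|$. Then the approximate reflection map $\widetilde T_\lambda:\varGamma\to\Omega$ (the reflection map of the radial graph of $\tilde\rho_\lambda$) is given by $$z=\widetilde T_\lambda(x)=\frac{-2\tilde\rho_\lambda^2D\tilde\rho_\lambda}{|D\tilde\rho_\lambda|^2-(\tilde\rho_\lambda+D\tilde\rho_\lambda\cdot x)^2}+\Bigl(x+\frac{2\tilde\rho_\lambda D\tilde\rho_\lambda}{|D\tilde\rho_\lambda|^2-(\tilde\rho_\lambda+D\tilde\rho_\lambda\cdot x)^2}\Bigr)\frac{z_{n+1}}{x_{n+1}},$$ where $z_{n+1}=h$ and the gradient is $$D\tilde\rho_\lambda(x)=\frac{\sum_i\exp(-f(x,z_i)/\lambda)\,(\varepsilon_if^2(x,z_i)/d_i)\,(\hat z_i-x\,\hat z_{i,n+1}/x_{n+1})}{\sum_i\exp(-f(x,z_i)/\lambda)}.$$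
   Context: $S^n\subset\mathbb R^{n+1}$ is the unit sphere, $S^n_+=\{m\in S^n:m_{n+1}>0\}$, $\varGamma\subset S^n_+$ is compact, and $\Omega\subset P=\{z\in\mathbb R^{n+1}:z_{n+1}=h\}$ with fixed $h<0$. $\hat z_{i,n+1}$ is the $(n+1)$-st component of $\hat z_i$. $D$ denotes the gradient in the coordinates $t=(t^1,\dots,t^n)$, $|t|<1$, on $S^n_+$ given by $x_k=t^k$ ($k\le n$), $x_{n+1}=\sqrt{1-|t|^2}$; the vector $D\rho=(\partial_{t^1}\rho,\dots,\partial_{t^n}\rho)$ is identified with $(D\rho,0)\in\mathbb R^{n+1}$. Reflection map of a smooth radial graph $\{x\rho(x):x\in\varGamma\}$, $\rho>0$: let $\upsilon(x)$ be the unit normal at $x\rho(x)$, let $y(x)=x-2(x\cdot\upsilon(x))\upsilon(x)$ be the reflected direction of the ray emitted from the origin in direction $x$, and let $l(x)$ be the travel distance along $y(x)$ from $x\rho(x)$ to the plane $P$, i.e. $x_{n+1}\rho(x)+y_{n+1}(x)l(x)=h$ (the reflected rays are assumed to meet $P$). The reflection map is $T(x)=x\rho(x)+y(x)l(x)$. *)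

theory Defs
  imports "HOL-Analysis.Analysis"
begin

text \<open>
  Points of \<open>R^(n+1)\<close> are pairs \<open>(m', m_(n+1))\<close> of type \<open>(real^'n) \<times> real\<close>, with \<open>n = CARD('n)\<close>;
  inner product and norm of the product type are the Euclidean ones.  Hence \<open>snd\<close> is the
  \<open>(n+1)\<close>-st component, and for \<open>x\<close> in the open upper hemisphere \<open>fst x\<close> is its coordinate
  vector \<open>t\<close>.
\<close>

definition upper_hemisphere :: "((real^'n) \<times> real) set" where
  "upper_hemisphere = {m \<in> sphere 0 1. snd m > 0}"

definition target_plane :: "real \<Rightarrow> ((real^'n) \<times> real) set" where
  "target_plane h = {z. snd z = h}"

definition hemi_chart :: "real^'n \<Rightarrow> (real^'n) \<times> real" where
  "hemi_chart t = (t, sqrt (1 - (norm t)\<^sup>2))"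

definition partial_deriv :: "'n \<Rightarrow> (real^'n \<Rightarrow> 'b::real_normed_vector) \<Rightarrow> real^'n \<Rightarrow> 'b" where
  "partial_deriv k F t = vector_derivative (\<lambda>s. F (t + s *\<^sub>R axis k 1)) (at 0)"

definition hemi_grad ::
    "((real^'n) \<times> real \<Rightarrow> real) \<Rightarrow> (real^'n) \<times> real \<Rightarrow> (real^'n) \<times> real" where
  "hemi_grad \<rho> x = ((\<chi> k. partial_deriv k (\<lambda>t. \<rho> (hemi_chart t)) (fst x)), 0)"

text \<open>
  A unit normal at \<open>x \<rho>(x)\<close> is a unit vector orthogonal to the coordinate tangent vectors of the
  radial graph.  It is determined only up to sign, but the reflected direction does not depend
  on that sign.
\<close>

definition is_unit_normal ::
    "((real^'n) \<times> real \<Rightarrow> real) \<Rightarrow> (real^'n) \<times> real \<Rightarrow> (real^'n) \<times> real \<Rightarrow> bool" where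
  "is_unit_normal \<rho> x \<upsilon> \<longleftrightarrow> norm \<upsilon> = 1 \<and>
     (\<forall>k. \<upsilon> \<bullet> partial_deriv k (\<lambda>t. \<rho> (hemi_chart t) *\<^sub>R hemi_chart t) (fst x) = 0)"

definition unit_normal ::
    "((real^'n) \<times> real \<Rightarrow> real) \<Rightarrow> (real^'n) \<times> real \<Rightarrow> (real^'n) \<times> real" where
  "unit_normal \<rho> x = (SOME \<upsilon>. is_unit_normal \<rho> x \<upsilon>)"

definition reflected_dir ::
    "((real^'n) \<times> real \<Rightarrow> real) \<Rightarrow> (real^'n) \<times> real \<Rightarrow> (real^'n) \<times> real" where
  "reflected_dir \<rho> x = x - (2 * (x \<bullet> unit_normal \<rho> x)) *\<^sub>R unit_normal \<rho> x"

definition reflected_ray_meets ::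
    "((real^'n) \<times> real \<Rightarrow> real) \<Rightarrow> real \<Rightarrow> (real^'n) \<times> real \<Rightarrow> bool" where
  "reflected_ray_meets \<rho> h x \<longleftrightarrow>
     (\<exists>l\<ge>0. \<rho> x *\<^sub>R x + l *\<^sub>R reflected_dir \<rho> x \<in> target_plane h)"

definition travel_dist ::
    "((real^'n) \<times> real \<Rightarrow> real) \<Rightarrow> real \<Rightarrow> (real^'n) \<times> real \<Rightarrow> real" where
  "travel_dist \<rho> h x =
     (THE l. l \<ge> 0 \<and> snd x * \<rho> x + snd (reflected_dir \<rho> x) * l = h)"

definition reflection_map ::
    "((real^'n) \<times> real \<Rightarrow> real) \<Rightarrow> real \<Rightarrow> (real^'n) \<times> real \<Rightarrow> (real^'n) \<times> real" where
  "reflection_map \<rho> h x = \<rho> x *\<^sub>R x + travel_dist \<rho> h x *\<^sub>R reflected_dir \<rho> x"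

definition eccentricity :: "real \<Rightarrow> (real^'n) \<times> real \<Rightarrow> real" where
  "eccentricity d z = sqrt (1 + d\<^sup>2 / (norm z)\<^sup>2) - d / norm z"

text \<open>
  Polar radius of the ellipsoid of revolution with foci \<open>0\<close>, \<open>z\<close> and focal parameter \<open>d\<close>;
  \<open>sgn z\<close> is the library's \<open>z / |z|\<close>.
\<close>

definition ellipsoid_radius :: "real \<Rightarrow> (real^'n) \<times> real \<Rightarrow> (real^'n) \<times> real \<Rightarrow> real" where
  "ellipsoid_radius d z x = d / (1 - eccentricity d z * (sgn z \<bullet> x))"

text \<open>
  The reflecting surface is the radial graph of the minimum of the radii
  \<open>ellipsoid_radius (d i) (z i)\<close>, so it is represented by the data \<open>d\<close>, \<open>z\<close>.
\<close>

definition softmin_radius ::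
    "nat \<Rightarrow> (nat \<Rightarrow> real) \<Rightarrow> (nat \<Rightarrow> (real^'n) \<times> real) \<Rightarrow> real \<Rightarrow> (real^'n) \<times> real \<Rightarrow> real" where
  "softmin_radius K d z lam x =
     - lam * ln (\<Sum>i=1..K. exp (- ellipsoid_radius (d i) (z i) x / lam))"

end

theory Submission
  imports Defs
begin

text \<open>
  Write \<open>g\<close> for the gradient of \<open>\<rho>\<close> at \<open>x\<close>, \<open>r = \<rho>(x)\<close>, \<open>q = g \<bullet> x\<close>.  The tangent vectors of the
  graph are \<open>g\<^sub>k x + r \<partial>\<^sub>k x\<close>, which forces every normal to be a multiple of \<open>(r + q) x - g\<close>; this
  vector has squared norm \<open>B = r\<^sup>2 - q\<^sup>2 + |g|\<^sup>2\<close>.  Reflecting \<open>x\<close> in it gives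
  \<open>y = (A x + 2 r g) / B\<close> with \<open>A = |g|\<^sup>2 - (r + q)\<^sup>2\<close>.  As \<open>g\<close> is horizontal, the vertical component
  of \<open>y\<close> is \<open>A x\<^sub>n\<^sub>+\<^sub>1 / B\<close>; a reflected ray that reaches the plane below the origin has \<open>A \<noteq> 0\<close>, and
  solving for its length yields the formula for the reflection map.
\<close>

section \<open>Calculus in the chart of the open upper hemisphere\<close>

lemma upper_hemisphereD:
  assumes "x \<in> upper_hemisphere"
  shows "norm x = 1" "snd x > 0" "hemi_chart (fst x) = x"
proof -
  show n1: "norm x = 1" and s: "snd x > 0"
    using assms by (auto simp: upper_hemisphere_def)
  have sq: "(norm (fst x))\<^sup>2 + (snd x)\<^sup>2 = 1"
    using n1 by (cases x) (simp add: norm_Pair)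
  then have "sqrt (1 - (norm (fst x))\<^sup>2) = snd x"
    using s by (intro real_sqrt_unique) auto
  then show "hemi_chart (fst x) = x"
    by (simp add: hemi_chart_def prod_eq_iff)
qed

lemma hemi_chart_has_derivative:
  assumes "x \<in> upper_hemisphere"
  shows "(hemi_chart has_derivative (\<lambda>v. (v, - (fst x \<bullet> v) / snd x))) (at (fst x))"
proof -
  \<comment> \<open>The norm is not differentiable at the origin, the coordinate of the pole; the
    inner product is smooth everywhere.\<close>
  have chart: "hemi_chart = (\<lambda>t. (t, sqrt (1 - t \<bullet> t)))"
    by (simp add: hemi_chart_def power2_norm_eq_inner fun_eq_iff)
  have snd_eq: "sqrt (1 - fst x \<bullet> fst x) = snd x"
    using arg_cong[OF upper_hemisphereD(3)[OF assms], of snd] by (simp add: chart)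
  have pos: "0 < 1 - fst x \<bullet> fst x"
    using snd_eq upper_hemisphereD(2)[OF assms] by (metis real_sqrt_gt_0_iff)
  have "((\<lambda>t. sqrt (1 - t \<bullet> t)) has_derivative (\<lambda>v. - (fst x \<bullet> v) / snd x)) (at (fst x))"
    using pos by (auto intro!: derivative_eq_intros simp: snd_eq inner_commute field_simps)
  then show ?thesis
    unfolding chart by (intro has_derivative_Pair has_derivative_ident)
qed

text \<open>\<open>vector_derivative\<close> is meaningful only where a derivative exists. A total
  derivative guarantees this by the chain rule along the coordinate line, so total derivatives are
  carried through all later arguments.\<close>

lemma partial_deriv_eq:
  assumes "(F has_derivative F') (at t)"
  shows "partial_deriv k F t = F' (axis k 1)"
proof -
  have lin: "((\<lambda>s. t + s *\<^sub>R axis k 1) has_derivative (\<lambda>s. s *\<^sub>R axis k 1)) (at 0)"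
    by (auto intro!: derivative_eq_intros)
  have "((\<lambda>s. F (t + s *\<^sub>R axis k 1)) has_derivative (\<lambda>s. F' (s *\<^sub>R axis k 1))) (at 0)"
    using has_derivative_compose[OF lin, of F F'] assms by simp
  moreover have "F' (s *\<^sub>R axis k 1) = s *\<^sub>R F' (axis k 1)" for s
    using has_derivative_bounded_linear[OF assms]
    by (simp add: linear_simps)
  ultimately show ?thesis
    unfolding partial_deriv_def
    by (intro vector_derivative_at) (simp add: has_vector_derivative_def)
qed

lemma hemi_grad_eq:
  assumes "((\<lambda>t. \<rho> (hemi_chart t)) has_derivative (\<lambda>v. a \<bullet> v)) (at (fst x))"
  shows "hemi_grad \<rho> x = (a, 0)"
  by (simp add: hemi_grad_def partial_deriv_eq[OF assms] inner_axis vec_eq_iff)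

section \<open>Reflection at a radial graph\<close>

lemma is_unit_normal_iff:
  fixes x :: "(real^'n) \<times> real"
  assumes x: "x \<in> upper_hemisphere"
    and D: "((\<lambda>t. \<rho> (hemi_chart t)) has_derivative (\<lambda>v. a \<bullet> v)) (at (fst x))"
  shows "is_unit_normal \<rho> x \<upsilon> \<longleftrightarrow> norm \<upsilon> = 1 \<and>
    \<rho> x *\<^sub>R \<upsilon> = (\<rho> x * snd \<upsilon> / snd x) *\<^sub>R x - (x \<bullet> \<upsilon>) *\<^sub>R (a, 0)"
proof -
  have s: "snd x > 0" and c: "hemi_chart (fst x) = x"
    using upper_hemisphereD[OF x] by auto
  have "partial_deriv k (\<lambda>t. \<rho> (hemi_chart t) *\<^sub>R hemi_chart t) (fst x)
      = \<rho> x *\<^sub>R (axis k 1, - (fst x $ k) / snd x) + (a $ k) *\<^sub>R x" for k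
    using partial_deriv_eq[OF has_derivative_scaleR[OF D hemi_chart_has_derivative[OF x]], of k]
    by (simp add: c inner_axis)
  then have "\<upsilon> \<bullet> partial_deriv k (\<lambda>t. \<rho> (hemi_chart t) *\<^sub>R hemi_chart t) (fst x)
      = \<rho> x * fst \<upsilon> $ k - (\<rho> x * snd \<upsilon> / snd x) * fst x $ k + (x \<bullet> \<upsilon>) * a $ k" for k
    by (simp add: inner_add_right inner_prod_def inner_axis inner_commute algebra_simps)
  then have "is_unit_normal \<rho> x \<upsilon> \<longleftrightarrow> norm \<upsilon> = 1 \<and>
      (\<forall>k. \<rho> x * fst \<upsilon> $ k = (\<rho> x * snd \<upsilon> / snd x) * fst x $ k - (x \<bullet> \<upsilon>) * a $ k)"
    unfolding is_unit_normal_def by (auto simp: algebra_simps)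
  also have "\<dots> \<longleftrightarrow> norm \<upsilon> = 1 \<and>
      \<rho> x *\<^sub>R \<upsilon> = (\<rho> x * snd \<upsilon> / snd x) *\<^sub>R x - (x \<bullet> \<upsilon>) *\<^sub>R (a, 0)"
    \<comment> \<open>The vertical component of the vector equation is trivially true, since
      \<open>(a, 0)\<close> is horizontal; the horizontal ones are the tangency conditions.\<close>
    using s by (auto simp: prod_eq_iff vec_eq_iff)
  finally show ?thesis .
qed

text \<open>Reflection involves the normal only through
  \<open>(x \<bullet> \<upsilon>) *\<^sub>R \<upsilon>\<close>, which is invariant under a change of
  sign. So the equation satisfied by the normal determines the reflected direction, whichever normal
  \<open>SOME\<close> picks.\<close>

lemma reflected_dir_eq:
  fixes \<rho> :: "(real^'n) \<times> real \<Rightarrow> real" and x :: "(real^'n) \<times> real"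
  defines "r \<equiv> \<rho> x" and "g \<equiv> hemi_grad \<rho> x"
  assumes x: "x \<in> upper_hemisphere"
    and D: "((\<lambda>t. \<rho> (hemi_chart t)) has_derivative (\<lambda>v. a \<bullet> v)) (at (fst x))"
    and r: "\<rho> x > 0"
  shows "r\<^sup>2 - (g \<bullet> x)\<^sup>2 + (norm g)\<^sup>2 > 0"
    and "reflected_dir \<rho> x = (1 / (r\<^sup>2 - (g \<bullet> x)\<^sup>2 + (norm g)\<^sup>2)) *\<^sub>R
      (((norm g)\<^sup>2 - (r + g \<bullet> x)\<^sup>2) *\<^sub>R x + (2 * r) *\<^sub>R g)"
proof -
  have g: "g = (a, 0)"
    unfolding g_def by (rule hemi_grad_eq[OF D])
  have s: "snd x > 0" and nx: "norm x = 1" and r0: "r > 0"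
    using upper_hemisphereD[OF x] r by (auto simp: r_def)
  have xx: "x \<bullet> x = 1"
    using nx by (simp add: norm_eq_1)
  define q where "q = g \<bullet> x"
  define B where "B = r\<^sup>2 - q\<^sup>2 + (norm g)\<^sup>2"
  define m where "m = (r + q) *\<^sub>R x - g"
  \<comment> \<open>As \<open>x\<close> has norm 1, Cauchy-Schwarz yields
    \<open>B \<ge> r\<^sup>2 > 0\<close>.\<close>
  have "\<bar>q\<bar> \<le> norm g"
    using Cauchy_Schwarz_ineq2[of g x] nx by (simp add: q_def)
  then have "q\<^sup>2 \<le> (norm g)\<^sup>2"
    by (metis abs_ge_zero power2_abs power_mono)
  moreover have "r\<^sup>2 > 0"
    using r0 by simp
  ultimately have B0: "B > 0"
    unfolding B_def by linarith
  then show "r\<^sup>2 - (g \<bullet> x)\<^sup>2 + (norm g)\<^sup>2 > 0"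
    by (simp add: B_def q_def)
  have xm: "x \<bullet> m = r"
    by (simp add: m_def inner_diff_right xx q_def inner_commute)
  have mm: "m \<bullet> m = B"
    by (simp add: m_def B_def inner_diff_left inner_diff_right xx q_def inner_commute
        power2_norm_eq_inner) (simp add: algebra_simps power2_eq_square)
  have normal_iff: "is_unit_normal \<rho> x \<upsilon> \<longleftrightarrow>
      norm \<upsilon> = 1 \<and> r *\<^sub>R \<upsilon> = (r * snd \<upsilon> / snd x) *\<^sub>R x - (x \<bullet> \<upsilon>) *\<^sub>R g" for \<upsilon>
    unfolding g r_def by (rule is_unit_normal_iff[OF x D])
  \<comment> \<open>\<open>SOME\<close> needs a witness before anything is known about its value:
    the normalized \<open>m\<close>.\<close>
  have "norm m = sqrt B"
    by (simp add: norm_eq_sqrt_inner mm)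
  moreover have "snd m = (r + q) * snd x"
    by (simp add: m_def g)
  ultimately have "is_unit_normal \<rho> x ((1 / sqrt B) *\<^sub>R m)"
    unfolding normal_iff using B0 s
    by (simp add: xm) (simp add: m_def scaleR_diff_right mult.commute)
  then have "is_unit_normal \<rho> x (unit_normal \<rho> x)"
    unfolding unit_normal_def by (rule someI)
  moreover define \<upsilon> where "\<upsilon> = unit_normal \<rho> x"
  moreover define c where "c = x \<bullet> \<upsilon>"
  ultimately have n1: "norm \<upsilon> = 1" and eq: "r *\<^sub>R \<upsilon> = (r * snd \<upsilon> / snd x) *\<^sub>R x - c *\<^sub>R g"
    unfolding normal_iff by auto
  \<comment> \<open>Pairing with \<open>x\<close> eliminates the unknown
    \<open>snd \<upsilon>\<close> and leaves \<open>\<upsilon>\<close> parallel to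
    \<open>m\<close>.\<close>
  have "r * c = r * snd \<upsilon> / snd x - c * q"
    using arg_cong[OF eq, of "\<lambda>u. x \<bullet> u"]
    by (simp add: inner_diff_right xx c_def q_def inner_commute)
  then have "r * snd \<upsilon> / snd x = c * (r + q)"
    by (simp add: algebra_simps)
  with eq have \<upsilon>m: "r *\<^sub>R \<upsilon> = c *\<^sub>R m"
    by (simp add: m_def scaleR_diff_right)
  \<comment> \<open>Comparing norms fixes \<open>c\<close> up to sign; the reflection needs only
    \<open>c\<^sup>2\<close>.\<close>
  have "(r *\<^sub>R \<upsilon>) \<bullet> (r *\<^sub>R \<upsilon>) = c\<^sup>2 * B"
    unfolding \<upsilon>m by (simp add: mm power2_eq_square)
  then have cB: "c\<^sup>2 * B = r\<^sup>2"
    using n1 by (simp add: norm_eq_1 power2_eq_square)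
  have "c *\<^sub>R \<upsilon> = (c / r) *\<^sub>R (r *\<^sub>R \<upsilon>)"
    using r0 by simp
  also have "\<dots> = (c\<^sup>2 / r) *\<^sub>R m"
    unfolding \<upsilon>m by (simp add: power2_eq_square)
  also have "c\<^sup>2 / r = r / B"
    using cB B0 r0 by (simp add: field_simps power2_eq_square)
  finally have "reflected_dir \<rho> x = x - (2 * (r / B)) *\<^sub>R m"
    unfolding reflected_dir_def \<upsilon>_def[symmetric] c_def[symmetric]
    by (metis scaleR_scaleR)
  also have "\<dots> = (1 / B) *\<^sub>R (B *\<^sub>R x - (2 * r) *\<^sub>R m)"
    using B0 by (simp add: scaleR_diff_right)
  also have "B *\<^sub>R x - (2 * r) *\<^sub>R m = (B - 2 * r * (r + q)) *\<^sub>R x + (2 * r) *\<^sub>R g"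
    by (simp add: m_def algebra_simps)
  also have "B - 2 * r * (r + q) = (norm g)\<^sup>2 - (r + q)\<^sup>2"
    by (simp add: B_def algebra_simps power2_eq_square)
  finally show "reflected_dir \<rho> x = (1 / (r\<^sup>2 - (g \<bullet> x)\<^sup>2 + (norm g)\<^sup>2)) *\<^sub>R
      (((norm g)\<^sup>2 - (r + g \<bullet> x)\<^sup>2) *\<^sub>R x + (2 * r) *\<^sub>R g)"
    by (simp add: B_def q_def)
qed

lemma reflection_map_eq:
  fixes \<rho> :: "(real^'n) \<times> real \<Rightarrow> real" and x :: "(real^'n) \<times> real"
  defines "r \<equiv> \<rho> x" and "g \<equiv> hemi_grad \<rho> x"
  defines "A \<equiv> (norm g)\<^sup>2 - (r + g \<bullet> x)\<^sup>2"
  assumes x: "x \<in> upper_hemisphere"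
    and D: "((\<lambda>t. \<rho> (hemi_chart t)) has_derivative (\<lambda>v. a \<bullet> v)) (at (fst x))"
    and r: "\<rho> x > 0" and h: "h < 0" and meets: "reflected_ray_meets \<rho> h x"
  shows "A \<noteq> 0"
    and "reflection_map \<rho> h x = (- 2 * r\<^sup>2 / A) *\<^sub>R g + (h / snd x) *\<^sub>R (x + (2 * r / A) *\<^sub>R g)"
    and "snd (reflection_map \<rho> h x) = h"
proof -
  define B where "B = r\<^sup>2 - (g \<bullet> x)\<^sup>2 + (norm g)\<^sup>2"
  define y where "y = reflected_dir \<rho> x"
  define l where "l = travel_dist \<rho> h x"
  have B0: "B > 0" and y: "y = (1 / B) *\<^sub>R (A *\<^sub>R x + (2 * r) *\<^sub>R g)"
    using reflected_dir_eq[OF x D r] by (simp_all add: B_def y_def A_def r_def g_def)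
  have s: "snd x > 0"
    by (rule upper_hemisphereD(2)[OF x])
  have "snd g = 0"
    by (simp add: g_def hemi_grad_def)
  then have sy: "snd y = A * snd x / B"
    by (simp add: y)
  obtain l' where l': "l' \<ge> 0" "snd x * r + snd y * l' = h"
    using meets by (auto simp: reflected_ray_meets_def target_plane_def r_def y_def mult.commute)
  \<comment> \<open>The reflection point lies above height 0 and the plane below it, so the ray
    cannot be horizontal.\<close>
  have "snd x * r > 0"
    using s r by (simp add: r_def)
  then have "snd y \<noteq> 0"
    using l' h by auto
  then show A0: "A \<noteq> 0"
    by (auto simp: sy)
  \<comment> \<open>The height equation is linear in the length with nonzero slope, so
    \<open>THE\<close> has a unique candidate.\<close>
  have "l = l'"
    unfolding l_def travel_dist_def y_def[symmetric] r_def[symmetric]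
    using l' \<open>snd y \<noteq> 0\<close> by (intro the_equality) auto
  with l' have hit: "snd x * r + snd y * l = h"
    by simp
  have T: "reflection_map \<rho> h x = r *\<^sub>R x + l *\<^sub>R y"
    by (simp add: reflection_map_def r_def l_def y_def)
  show "snd (reflection_map \<rho> h x) = h"
    using hit by (simp add: T mult.commute)
  have lB: "l / B = (h / snd x - r) / A"
    using hit A0 B0 s by (simp add: sy field_simps)
  have "r *\<^sub>R x + l *\<^sub>R y = r *\<^sub>R x + (l / B) *\<^sub>R (A *\<^sub>R x + (2 * r) *\<^sub>R g)"
    by (simp add: y)
  \<comment> \<open>The coefficient of \<open>x\<close> is \<open>r + (l / B) * A\<close>, in which
    \<open>r\<close> cancels.\<close>
  also have "\<dots> = (h / snd x) *\<^sub>R x + ((h / snd x - r) * (2 * r / A)) *\<^sub>R g"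
    unfolding lB using A0 by (simp add: scaleR_add_right scaleR_diff_left)
  also have "(h / snd x - r) * (2 * r / A) = - 2 * r\<^sup>2 / A + (h / snd x) * (2 * r / A)"
    using A0 s by (simp add: field_simps power2_eq_square)
  finally show "reflection_map \<rho> h x
      = (- 2 * r\<^sup>2 / A) *\<^sub>R g + (h / snd x) *\<^sub>R (x + (2 * r / A) *\<^sub>R g)"
    by (simp add: T scaleR_diff_left scaleR_add_right add_ac)
qed

section \<open>Ellipsoids and their softmin\<close>

lemma eccentricity_bounds:
  assumes "d > 0" and "z \<noteq> 0"
  shows "0 < eccentricity d z" and "eccentricity d z < 1"
proof -
  \<comment> \<open>In terms of \<open>u\<close> the two bounds are
    \<open>u\<^sup>2 < 1 + u\<^sup>2 < (1 + u)\<^sup>2\<close>.\<close>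
  define u where "u = d / norm z"
  have u: "u > 0" and e: "eccentricity d z = sqrt (1 + u\<^sup>2) - u"
    using assms by (simp_all add: u_def eccentricity_def power_divide)
  show "0 < eccentricity d z"
    using real_less_rsqrt[of u "1 + u\<^sup>2"] by (simp add: e)
  have "1 + u\<^sup>2 < (1 + u)\<^sup>2"
    using u by (simp add: power2_eq_square algebra_simps)
  then have "sqrt (1 + u\<^sup>2) < 1 + u"
    using u by (intro real_less_lsqrt) auto
  then show "eccentricity d z < 1"
    by (simp add: e)
qed

lemma ellipsoid_radius_has_derivative:
  fixes x :: "(real^'n) \<times> real"
  assumes x: "x \<in> upper_hemisphere" and d: "d > 0" and z: "z \<noteq> 0"
  shows "((\<lambda>t. ellipsoid_radius d z (hemi_chart t)) has_derivative
    (\<lambda>v. ((eccentricity d z * (ellipsoid_radius d z x)\<^sup>2 / d) *\<^sub>R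
      fst (sgn z - (snd (sgn z) / snd x) *\<^sub>R x)) \<bullet> v)) (at (fst x))"
proof -
  have c: "hemi_chart (fst x) = x" and nx: "norm x = 1"
    using upper_hemisphereD[OF x] by auto
  define e where "e = eccentricity d z"
  have e: "0 < e" "e < 1"
    using eccentricity_bounds[OF d z] by (auto simp: e_def)
  \<comment> \<open>The denominator of the polar radius is at least \<open>1 - e\<close>, which is
    positive.\<close>
  have "sgn z \<bullet> x \<le> 1"
    using norm_cauchy_schwarz[of "sgn z" x] z nx by (simp add: norm_sgn)
  then have "e * (sgn z \<bullet> x) \<le> e * 1"
    using e by (intro mult_left_mono) auto
  then have nz: "1 - e * (sgn z \<bullet> x) \<noteq> 0"
    using e by linarith
  have "((\<lambda>t. d / (1 - e * (sgn z \<bullet> hemi_chart t))) has_derivative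
      (\<lambda>v. (d * (e * (sgn z \<bullet> (v, - (fst x \<bullet> v) / snd x)))) / (1 - e * (sgn z \<bullet> x))\<^sup>2)) (at (fst x))"
    using nz
    by (auto intro!: derivative_eq_intros hemi_chart_has_derivative[OF x]
        simp: c power2_eq_square)
  moreover have "d * (e * (sgn z \<bullet> (v, - (fst x \<bullet> v) / snd x))) / (1 - e * (sgn z \<bullet> x))\<^sup>2
      = ((e * (ellipsoid_radius d z x)\<^sup>2 / d) *\<^sub>R fst (sgn z - (snd (sgn z) / snd x) *\<^sub>R x)) \<bullet> v" for v
  proof -
    \<comment> \<open>The vertical part of a tangent vector depends on its horizontal part
      \<open>v\<close>; collecting the terms in \<open>v\<close> produces the correction by a
      multiple of \<open>x\<close> in the gradient formula.\<close>
    have "sgn z \<bullet> (v, - (fst x \<bullet> v) / snd x) = fst (sgn z - (snd (sgn z) / snd x) *\<^sub>R x) \<bullet> v"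
      by (simp add: inner_prod_def inner_diff_left)
    moreover have "d * e / (1 - e * (sgn z \<bullet> x))\<^sup>2 = e * (ellipsoid_radius d z x)\<^sup>2 / d"
      using d by (simp add: ellipsoid_radius_def e_def power_divide power2_eq_square)
    ultimately show ?thesis
      by (simp add: mult.assoc[symmetric] flip: times_divide_eq_left)
  qed
  ultimately show ?thesis
    by (simp add: ellipsoid_radius_def e_def)
qed

text \<open>The factor \<open>- lam\<close> cancels the \<open>- 1 / lam\<close> from the exponents,
  so the gradient is the mean of the \<open>a i\<close> with weights proportional to
  \<open>exp (- f i / lam)\<close>.\<close>

lemma softmin_radius_has_derivative:
  fixes d :: "nat \<Rightarrow> real" and z :: "nat \<Rightarrow> (real^'n) \<times> real"
    and x :: "(real^'n) \<times> real"
  defines "f \<equiv> \<lambda>i. ellipsoid_radius (d i) (z i) x"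
  assumes lam: "lam \<noteq> 0" and K: "K \<ge> 1" and c: "hemi_chart (fst x) = x"
    and D: "\<And>i. i \<in> {1..K} \<Longrightarrow> ((\<lambda>t. ellipsoid_radius (d i) (z i) (hemi_chart t)) has_derivative
      (\<lambda>v. a i \<bullet> v)) (at (fst x))"
  shows "((\<lambda>t. softmin_radius K d z lam (hemi_chart t)) has_derivative
    (\<lambda>v. ((1 / (\<Sum>i=1..K. exp (- f i / lam))) *\<^sub>R
      (\<Sum>i=1..K. exp (- f i / lam) *\<^sub>R a i)) \<bullet> v)) (at (fst x))"
proof -
  define S where "S = (\<Sum>i=1..K. exp (- f i / lam))"
  \<comment> \<open>With at least one summand the argument of \<open>ln\<close> is positive.\<close>
  have S0: "S > 0"
    unfolding S_def using K by (intro sum_pos) auto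
  have "((\<lambda>t. exp (- ellipsoid_radius (d i) (z i) (hemi_chart t) / lam)) has_derivative
      (\<lambda>v. exp (- f i / lam) * (- (a i \<bullet> v) / lam))) (at (fst x))" if "i \<in> {1..K}" for i
    using lam by (auto intro!: derivative_eq_intros D[OF that] simp: f_def c)
  then have sum: "((\<lambda>t. \<Sum>i=1..K. exp (- ellipsoid_radius (d i) (z i) (hemi_chart t) / lam))
      has_derivative (\<lambda>v. \<Sum>i=1..K. exp (- f i / lam) * (- (a i \<bullet> v) / lam))) (at (fst x))"
    by (rule has_derivative_sum)
  have "((\<lambda>t. softmin_radius K d z lam (hemi_chart t)) has_derivative
      (\<lambda>v. - lam * ((\<Sum>i=1..K. exp (- f i / lam) * (- (a i \<bullet> v) / lam)) * inverse S))) (at (fst x))"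
    unfolding softmin_radius_def
    using S0
    by (intro has_derivative_mult_right has_derivative_ln[OF _ sum, THEN has_derivative_eq_rhs])
      (auto simp: S_def f_def c mult.commute)
  moreover have "- lam * ((\<Sum>i=1..K. exp (- f i / lam) * (- (a i \<bullet> v) / lam)) * inverse S)
      = ((1 / S) *\<^sub>R (\<Sum>i=1..K. exp (- f i / lam) *\<^sub>R a i)) \<bullet> v" for v
    unfolding inner_scaleR_left inner_sum_left sum_distrib_left sum_distrib_right
    using lam S0 by (intro sum.cong refl) (simp add: field_simps)
  ultimately show ?thesis
    by (simp add: S_def)
qed

section \<open>The reflection map of the softmin radius\<close>

theorem proposition3p2:
  fixes \<Gamma> \<Omega> :: "((real^'n) \<times> real) set"
    and h lam :: real and K :: nat
    and d :: "nat \<Rightarrow> real" and z :: "nat \<Rightarrow> (real^'n) \<times> real"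
  assumes "compact \<Gamma>" and "\<Gamma> \<subseteq> upper_hemisphere"
    and "h < 0" and "\<Omega> \<subseteq> target_plane h"
    and "K \<ge> 1"
    and "\<And>i. i \<in> {1..K} \<Longrightarrow> z i \<in> \<Omega>"
    and "\<And>i. i \<in> {1..K} \<Longrightarrow> d i > 0"
    and "0 < lam" and "lam < 1"
    and radius_pos: "\<And>x. x \<in> \<Gamma> \<Longrightarrow> softmin_radius K d z lam x > 0"
    and rays_meet: "\<And>x. x \<in> \<Gamma> \<Longrightarrow> reflected_ray_meets (softmin_radius K d z lam) h x"
  shows "\<forall>x\<in>\<Gamma>.
    (let \<rho> = softmin_radius K d z lam;
         r = \<rho> x;
         g = hemi_grad \<rho> x;
         A = (norm g)\<^sup>2 - (r + g \<bullet> x)\<^sup>2;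
         T = reflection_map \<rho> h x;
         f = (\<lambda>i. ellipsoid_radius (d i) (z i) x)
     in A \<noteq> 0
      \<and> T = (- 2 * r\<^sup>2 / A) *\<^sub>R g + (snd T / snd x) *\<^sub>R (x + (2 * r / A) *\<^sub>R g)
      \<and> snd T = h
      \<and> (\<lambda>t. \<rho> (hemi_chart t)) differentiable (at (fst x))
      \<and> g = (1 / (\<Sum>i=1..K. exp (- f i / lam))) *\<^sub>R
            (\<Sum>i=1..K. (exp (- f i / lam) * (eccentricity (d i) (z i) * (f i)\<^sup>2 / d i)) *\<^sub>R
               (sgn (z i) - (snd (sgn (z i)) / snd x) *\<^sub>R x)))"
proof
  fix x assume xG: "x \<in> \<Gamma>"
  define \<rho> where "\<rho> = softmin_radius K d z lam"
  define f where "f = (\<lambda>i. ellipsoid_radius (d i) (z i) x)"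
  define w where "w i = sgn (z i) - (snd (sgn (z i)) / snd x) *\<^sub>R x" for i
  define b where "b i = eccentricity (d i) (z i) * (f i)\<^sup>2 / d i" for i
  define G where "G = (1 / (\<Sum>i=1..K. exp (- f i / lam))) *\<^sub>R
    (\<Sum>i=1..K. (exp (- f i / lam) * b i) *\<^sub>R w i)"
  have x: "x \<in> upper_hemisphere"
    using xG assms(2) by auto
  \<comment> \<open>The target plane misses the origin because \<open>h < 0\<close>.\<close>
  have z0: "z i \<noteq> 0" if "i \<in> {1..K}" for i
    using assms(3,4) assms(6)[OF that] by (auto simp: target_plane_def)
  have "((\<lambda>t. ellipsoid_radius (d i) (z i) (hemi_chart t)) has_derivative
      (\<lambda>v. (b i *\<^sub>R fst (w i)) \<bullet> v)) (at (fst x))" if "i \<in> {1..K}" for i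
    using ellipsoid_radius_has_derivative[OF x assms(7)[OF that] z0[OF that]]
    by (simp add: b_def w_def f_def)
  then have D: "((\<lambda>t. \<rho> (hemi_chart t)) has_derivative (\<lambda>v. fst G \<bullet> v)) (at (fst x))"
    using softmin_radius_has_derivative[of lam K x d z "\<lambda>i. b i *\<^sub>R fst (w i)"]
      assms(5,8) upper_hemisphereD(3)[OF x]
    by (simp add: G_def \<rho>_def f_def fst_sum)
  \<comment> \<open>Subtracting this multiple of \<open>x\<close> projects \<open>sgn (z i)\<close>
    along \<open>x\<close> to the horizontal hyperplane, in agreement with the identification of the
    gradient with a vector of last component 0.\<close>
  have "snd (w i) = 0" for i
    using upper_hemisphereD(2)[OF x] by (simp add: w_def)
  then have "snd G = 0"
    by (simp add: G_def snd_sum)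
  then have grad: "hemi_grad \<rho> x = G"
    using hemi_grad_eq[OF D] by (simp add: prod_eq_iff)
  \<comment> \<open>A softmin does not exceed the minimum and may fail to be positive although every
    \<open>f i\<close> is positive; hence positivity comes from \<open>radius_pos\<close>.\<close>
  have pos: "\<rho> x > 0" and meets: "reflected_ray_meets \<rho> h x"
    using radius_pos[OF xG] rays_meet[OF xG] by (simp_all add: \<rho>_def)
  note T = reflection_map_eq[OF x D pos assms(3) meets]
  have "(\<lambda>t. \<rho> (hemi_chart t)) differentiable (at (fst x))"
    using D by (rule differentiableI)
  with T grad show "let \<rho> = softmin_radius K d z lam;
         r = \<rho> x;
         g = hemi_grad \<rho> x;
         A = (norm g)\<^sup>2 - (r + g \<bullet> x)\<^sup>2;
         T = reflection_map \<rho> h x;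
         f = (\<lambda>i. ellipsoid_radius (d i) (z i) x)
     in A \<noteq> 0
      \<and> T = (- 2 * r\<^sup>2 / A) *\<^sub>R g + (snd T / snd x) *\<^sub>R (x + (2 * r / A) *\<^sub>R g)
      \<and> snd T = h
      \<and> (\<lambda>t. \<rho> (hemi_chart t)) differentiable (at (fst x))
      \<and> g = (1 / (\<Sum>i=1..K. exp (- f i / lam))) *\<^sub>R
            (\<Sum>i=1..K. (exp (- f i / lam) * (eccentricity (d i) (z i) * (f i)\<^sup>2 / d i)) *\<^sub>R
               (sgn (z i) - (snd (sgn (z i)) / snd x) *\<^sub>R x))"
    unfolding Let_def \<rho>_def[symmetric] by (simp only: G_def f_def b_def w_def) blast
qed

end
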